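(* Let $d \ge 1$ and let $\{A_k\}_{k=1}^\infty$ be a sequence of finite subsets of $\mathbb{R}_+^d$ satisfying $\# A_k \ge 2$ for each $k \ge 1$. For each $n \ge 1$ let $\nu_n = \delta_{A_1} * \delta_{A_2} * \cdots * \delta_{A_n}$. Then the sequence of convolutions $\{\nu_n\}$ converges weakly to a Borel probability measure on $\mathbb{R}^d$ if and only if $$\sum_{k=1}^{\infty} \frac{1}{\# A_k} \sum_{a\in A_k} \frac{|a|}{1+|a|} < \infty.$$
   Context: Notation: $\mathbb{R}_+ = [0,+\infty)$; $\#$ denotes the cardinality of a set; $|a|$ is the Euclidean norm of $a\in\mathbb{R}^d$. For a finite nonempty set $A \subseteq \mathbb{R}^d$, $\delta_A = \frac{1}{\# A} \sum_{a \in A} \delta_a$ is the uniform discrete probability measure on $A$, where $\delta_a$ is the Dirac measure at $a$. The symbol $*$ denotes convolution of measures. A sequence of Borel probability measures $\mu_n$ on $\mathbb{R}^d$ converges weakly to a Borel probability measure $\mu$ if $\int f \, d\mu_n \to \int f \, d\mu$ for every bounded continuous function $f$ on $\mathbb{R}^d$. *)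

theory Defs
  imports "HOL-Probability.Probability"
begin

text \<open>
  The uniform measure on \<open>A\<close> is a measure on the whole Borel sigma-algebra of the ambient space
  (unlike \<^const>\<open>uniform_count_measure\<close>, whose space is \<open>A\<close> itself), so that
  \<^const>\<open>convolution\<close> applies. \<^term>\<open>return borel a\<close> is the Dirac measure at \<open>a\<close>.
\<close>

definition unif_measure :: "'a::topological_space set \<Rightarrow> 'a measure" where
  "unif_measure A = measure_of UNIV (sets borel)
     (\<lambda>X. ennreal (1 / real (card A)) * (\<Sum>a\<in>A. emeasure (return borel a) X))"

lemma space_unif_measure [simp]: "space (unif_measure A) = UNIV"
  by (simp add: unif_measure_def)

lemma sets_unif_measure [simp, measurable_cong]: "sets (unif_measure A) = sets borel"
  by (simp add: unif_measure_def sets.sigma_sets_eq[of borel, simplified])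

lemma emeasure_unif_measure:
  assumes "X \<in> sets borel"
  shows "emeasure (unif_measure A) X =
    ennreal (1 / real (card A)) * (\<Sum>a\<in>A. emeasure (return borel a) X)"
proof (rule emeasure_measure_of[OF unif_measure_def])
  show "countably_additive (sets (unif_measure A))
     (\<lambda>X. ennreal (1 / real (card A)) * (\<Sum>a\<in>A. emeasure (return borel a) X))"
    unfolding countably_additive_def
  proof (intro allI impI)
    fix F :: "nat \<Rightarrow> 'a set"
    assume F: "range F \<subseteq> sets (unif_measure A)" "disjoint_family F"
    have "(\<Sum>i. \<Sum>a\<in>A. emeasure (return borel a) (F i)) =
        (\<Sum>a\<in>A. \<Sum>i. emeasure (return borel a) (F i))"
      by (rule suminf_sum) simp
    also have "\<dots> = (\<Sum>a\<in>A. emeasure (return borel a) (\<Union>i. F i))"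
      using F by (intro sum.cong refl suminf_emeasure) auto
    finally show "(\<Sum>i. ennreal (1 / real (card A)) * (\<Sum>a\<in>A. emeasure (return borel a) (F i))) =
        ennreal (1 / real (card A)) * (\<Sum>a\<in>A. emeasure (return borel a) (\<Union>i. F i))"
      by simp
  qed
qed (use assms in \<open>auto simp: positive_def\<close>)

lemma prob_space_unif_measure:
  assumes "finite A" "A \<noteq> {}"
  shows "prob_space (unif_measure A)"
proof
  have "real (card A) > 0"
    using assms by (simp add: card_gt_0_iff)
  then have "ennreal (1 / real (card A)) * of_nat (card A) = 1"
    unfolding ennreal_of_nat_eq_real_of_nat
    by (subst ennreal_mult'[symmetric]) simp_all
  then show "emeasure (unif_measure A) (space (unif_measure A)) = 1"
    by (simp add: emeasure_unif_measure)
qed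

text \<open>
  \<open>conv_seq A n\<close> is the convolution of the uniform measures on \<open>A 1, \<dots>, A n\<close>; the set \<open>A 0\<close> is never
  used. The value at \<open>0\<close> is the empty convolution, i.e. the Dirac measure at the origin, which is
  the unit of convolution (see \<open>conv_seq_1\<close> below).
\<close>

primrec conv_seq :: "(nat \<Rightarrow> 'a::ordered_euclidean_space set) \<Rightarrow> nat \<Rightarrow> 'a measure" where
  "conv_seq A 0 = return borel 0"
| "conv_seq A (Suc n) = convolution (conv_seq A n) (unif_measure (A (Suc n)))"

lemma conv_seq_1:
  assumes "finite (A 1)" "A 1 \<noteq> {}"
  shows "conv_seq A 1 = unif_measure (A 1)"
proof (rule measure_eqI)
  let ?U = "unif_measure (A 1)"
  have U: "finite_measure ?U"
    by (rule prob_space.finite_measure[OF prob_space_unif_measure[OF assms]])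
  interpret U: finite_measure ?U by (rule U)
  have R: "finite_measure (return borel (0::'a))"
    by (rule prob_space.finite_measure[OF prob_space_return]) simp
  show "sets (conv_seq A 1) = sets ?U"
    by simp
  fix X assume "X \<in> sets (conv_seq A 1)"
  then have X [measurable]: "X \<in> sets borel"
    by simp
  have meas: "(\<lambda>x. \<integral>\<^sup>+y. indicator X (x + y) \<partial>?U) \<in> borel_measurable borel"
    by (rule U.borel_measurable_nn_integral) measurable
  have "conv_seq A 1 = convolution (return borel 0) ?U"
    by (simp only: One_nat_def conv_seq.simps)
  then have "emeasure (conv_seq A 1) X =
      (\<integral>\<^sup>+x. \<integral>\<^sup>+y. indicator X (x + y) \<partial>?U \<partial>return borel 0)"
    by (simp only: convolution_emeasure'[OF X R U sets_unif_measure sets_return])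
  also have "\<dots> = (\<integral>\<^sup>+y. indicator X (0 + y) \<partial>?U)"
    by (rule nn_integral_return[OF _ meas]) simp
  also have "\<dots> = emeasure ?U X"
    using X by (simp only: add_0_left nn_integral_indicator sets_unif_measure)
  finally show "emeasure (conv_seq A 1) X = emeasure ?U X" .
qed

text \<open>
  Weak convergence in the sense of bounded continuous test functions. The library's
  \<^const>\<open>weak_conv_m\<close> is restricted to measures on the real line.
\<close>

definition weakly_converges :: "(nat \<Rightarrow> 'a::topological_space measure) \<Rightarrow> 'a measure \<Rightarrow> bool" where
  "weakly_converges \<mu> M \<longleftrightarrow>
     (\<forall>f :: 'a \<Rightarrow> real. continuous_on UNIV f \<and> bounded (range f) \<longrightarrow>
        (\<lambda>n. \<integral>x. f x \<partial>\<mu> n) \<longlonglongrightarrow> (\<integral>x. f x \<partial>M))"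

end

theory Submission
  imports Defs
begin

text \<open>
  Realise \<open>\<nu>\<^sub>n\<close> as the law of the partial sum \<open>S\<^sub>n = X\<^sub>0 + \<dots> + X\<^bsub>n-1\<^esub>\<close> of independent variables, \<open>X\<^sub>k\<close>
  being uniform on \<open>A (Suc k)\<close>. If the series converges, then \<open>\<Sum>k. |X\<^sub>k| / (1 + |X\<^sub>k|)\<close> has finite
  expectation, so almost surely it converges, hence so does \<open>\<Sum>k. |X\<^sub>k|\<close>; thus \<open>S\<^sub>n\<close> converges almost
  surely, and by dominated convergence in law.
  Conversely, \<open>x \<mapsto> exp (- |x|\<^sub>1)\<close>, with \<open>|x|\<^sub>1\<close> the \<open>\<ell>\<^sup>1\<close>-norm, is a bounded continuous function which is
  multiplicative on the nonnegative orthant, so its \<open>\<nu>\<^sub>n\<close>-integral is the product of its means \<open>m\<^sub>k\<close>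
  over the \<open>A (Suc k)\<close>. Weak convergence makes this product converge to a positive number, so
  \<open>\<Sum>k. 1 - m\<^sub>k\<close> is finite, and \<open>|x| / (1 + |x|) \<le> 1 - exp (- |x|\<^sub>1)\<close> bounds the series by it.
\<close>

section \<open>Uniform measures and a realisation by independent variables\<close>

lemma unif_measure_eq_distr:
  assumes "finite A" "A \<noteq> {}"
  shows "unif_measure (A :: 'a::t2_space set) = distr (measure_pmf (pmf_of_set A)) borel (\<lambda>x. x)"
proof (rule measure_eqI)
  fix X assume "X \<in> sets (unif_measure A)"
  then have X [measurable]: "X \<in> sets borel"
    by simp
  have "(\<Sum>a\<in>A. emeasure (return borel a) X) = of_nat (card (A \<inter> X))"
    using assms X by (simp add: indicator_def sum.If_cases Int_def)
  then show "emeasure (unif_measure A) X = emeasure (distr (measure_pmf (pmf_of_set A)) borel (\<lambda>x. x)) X"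
    using assms X
    by (simp add: emeasure_unif_measure emeasure_distr emeasure_pmf_of_set
        ennreal_of_nat_eq_real_of_nat flip: ennreal_mult')
qed simp

lemma AE_unif_measure:
  fixes A :: "'a::t2_space set"
  assumes "finite A" "A \<noteq> {}"
  shows "AE x in unif_measure A. x \<in> A"
proof -
  have "A \<in> sets borel"
    using assms by (intro borel_closed finite_imp_closed)
  then show ?thesis
    unfolding unif_measure_eq_distr[OF assms]
    using assms by (subst AE_distr_iff) (auto simp: AE_measure_pmf_iff)
qed

lemma
  fixes f :: "'a::t2_space \<Rightarrow> real"
  assumes "finite A" "A \<noteq> {}" and [measurable]: "f \<in> borel_measurable borel"
  shows integrable_unif_measure: "integrable (unif_measure A) f"
    and integral_unif_measure: "integral\<^sup>L (unif_measure A) f = 1 / real (card A) * (\<Sum>a\<in>A. f a)"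
  unfolding unif_measure_eq_distr[OF assms(1,2)]
  using assms
  by (simp_all add: integrable_distr_eq integrable_measure_pmf_finite
      integral_distr integral_pmf_of_set)

text \<open>The disjoint index blocks \<open>I\<close> and \<open>{i}\<close> give independent
  restricted families; the sum and the coordinate are measurable functions of these.\<close>

lemma (in prob_space) indep_var_sum_component:
  fixes X :: "'i \<Rightarrow> 'a \<Rightarrow> 'b::{second_countable_topology, topological_comm_monoid_add}"
  assumes I: "finite I" "i \<notin> I" and indep: "indep_vars (\<lambda>_. borel) X (insert i I)"
  shows "indep_var borel (\<lambda>\<omega>. \<Sum>i\<in>I. X i \<omega>) borel (X i)"
proof -
  have "indep_var
    borel ((\<lambda>f. \<Sum>i\<in>I. f i) \<circ> (\<lambda>\<omega>. restrict (\<lambda>i. X i \<omega>) I))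
    borel ((\<lambda>f. f i) \<circ> (\<lambda>\<omega>. restrict (\<lambda>i. X i \<omega>) {i}))"
    using I by (intro indep_var_compose[OF indep_var_restrict[OF indep]]) auto
  then show ?thesis
    by (simp add: comp_def cong: sum.cong)
qed

text \<open>Each convolution step adds one independent summand. The shift pairs \<open>X k\<close>
  with \<open>A (Suc k)\<close>, so \<open>A 0\<close> never enters, and the empty sum matches the
  Dirac measure at 0.\<close>

lemma (in prob_space) conv_seq_eq_distr:
  fixes X :: "nat \<Rightarrow> 'a \<Rightarrow> 'b::ordered_euclidean_space"
  assumes indep: "indep_vars (\<lambda>_. borel) X UNIV"
    and distr: "\<And>k. distr M borel (X k) = unif_measure (A (Suc k))"
  shows "conv_seq A n = distr M borel (\<lambda>\<omega>. \<Sum>k<n. X k \<omega>)"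
proof (induction n)
  case 0
  show ?case
    by (simp add: distr_const)
next
  case (Suc n)
  have [measurable]: "random_variable borel (X k)" for k
    using indep by (simp add: indep_vars_def)
  have "indep_var borel (\<lambda>\<omega>. \<Sum>k<n. X k \<omega>) borel (X n)"
    by (rule indep_var_sum_component) (auto intro: indep_vars_subset[OF indep])
  from sum_indep_random_variable[OF this] show ?case
    by (simp add: Suc.IH distr)
qed

text \<open>Take the infinite product of the uniform measures, with the coordinate projections as
  variables.\<close>

lemma conv_seq_coupling:
  fixes A :: "nat \<Rightarrow> 'a::ordered_euclidean_space set"
  assumes "\<And>k. finite (A (Suc k))" "\<And>k. A (Suc k) \<noteq> {}"
  obtains M :: "(nat \<Rightarrow> 'a) measure" and X :: "nat \<Rightarrow> (nat \<Rightarrow> 'a) \<Rightarrow> 'a"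
  where "prob_space M" "prob_space.indep_vars M (\<lambda>_. borel) X UNIV"
    "\<And>k. distr M borel (X k) = unif_measure (A (Suc k))"
proof -
  define U where "U k = unif_measure (A (Suc k))" for k
  have U: "prob_space (U k)" for k
    using assms by (simp add: U_def prob_space_unif_measure)
  have [measurable_cong]: "sets (U k) = sets borel" for k
    by (simp add: U_def)
  interpret product_prob_space U UNIV
    using U by (intro product_prob_spaceI)
  have d: "distr (PiM UNIV U) borel (\<lambda>\<omega>. \<omega> k) = U k" for k
    using PiM_component[of k] by (simp add: U_def cong: distr_cong)
  have sets: "sets (PiM UNIV U) = sets (PiM UNIV (\<lambda>_. borel))"
    by (intro sets_PiM_cong) (auto simp: U_def)
  \<comment> \<open>Independence means that the joint law is the product of the marginals; the joint
    map of all coordinates is the identity.\<close>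
  have "P.indep_vars (\<lambda>_. borel) (\<lambda>k \<omega>. \<omega> k) UNIV"
    by (subst P.indep_vars_iff_distr_eq_PiM')
       (simp_all add: d restrict_UNIV distr_id2 sets)
  with that[of "PiM UNIV U" "\<lambda>k \<omega>. \<omega> k"] d P.prob_space_axioms show thesis
    by (simp add: U_def)
qed

section \<open>Sufficiency of the series condition\<close>

text \<open>The ratios tend to 0, so eventually they are below 1/2. This forces
  \<open>r k \<le> 1\<close>, and then \<open>r k\<close> is at most twice its ratio.\<close>

lemma summable_of_summable_ratio:
  fixes r :: "nat \<Rightarrow> real"
  assumes nonneg: "\<And>k. r k \<ge> 0" and sm: "summable (\<lambda>k. r k / (1 + r k))"
  shows "summable r"
proof (rule summable_comparison_test_ev)
  have "eventually (\<lambda>k. r k / (1 + r k) < 1 / 2) sequentially"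
    using summable_LIMSEQ_zero[OF sm] by (rule order_tendstoD) simp
  then show "eventually (\<lambda>k. norm (r k) \<le> 2 * (r k / (1 + r k))) sequentially"
  proof eventually_elim
    case (elim k)
    have pos: "1 + r k > 0"
      using nonneg[of k] by linarith
    then have "r k \<le> 1"
      using elim by (simp add: field_simps)
    then have "r k * (1 + r k) \<le> r k * 2"
      using nonneg[of k] by (intro mult_left_mono) auto
    then show ?case
      using pos nonneg[of k] by (simp add: pos_le_divide_eq)
  qed
  show "summable (\<lambda>k. 2 * (r k / (1 + r k)))"
    by (intro summable_mult sm)
qed

lemma conv_seq_convergent_of_summable:
  fixes A :: "nat \<Rightarrow> 'a::ordered_euclidean_space set"
  assumes A: "\<And>k. finite (A (Suc k))" "\<And>k. A (Suc k) \<noteq> {}"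
    and sm: "summable (\<lambda>k. 1 / real (card (A (Suc k))) * (\<Sum>a\<in>A (Suc k). norm a / (1 + norm a)))"
      (is "summable ?c")
  shows "\<exists>\<mu>. sets \<mu> = sets borel \<and> prob_space \<mu> \<and> weakly_converges (conv_seq A) \<mu>"
proof -
  obtain M :: "(nat \<Rightarrow> 'a) measure" and X where M: "prob_space M"
    and indep: "prob_space.indep_vars M (\<lambda>_. borel) X UNIV"
    and distr: "\<And>k. distr M borel (X k) = unif_measure (A (Suc k))"
    by (rule conv_seq_coupling[of A]) (use A in auto)
  interpret prob_space M by fact
  have [measurable]: "random_variable borel (X k)" for k
    using indep by (simp add: indep_vars_def)
  define g where "g = (\<lambda>x::'a. norm x / (1 + norm x))"
  have [measurable]: "g \<in> borel_measurable borel"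
    unfolding g_def by measurable
  have g_nonneg: "g x \<ge> 0" for x
    by (simp add: g_def)
  have c_nonneg: "?c k \<ge> 0" for k
    by (intro mult_nonneg_nonneg sum_nonneg) auto
  have g_int: "(\<integral>\<^sup>+\<omega>. ennreal (g (X k \<omega>)) \<partial>M) = ennreal (?c k)" for k
  proof -
    have "(\<integral>\<^sup>+\<omega>. ennreal (g (X k \<omega>)) \<partial>M) = (\<integral>\<^sup>+x. ennreal (g x) \<partial>distr M borel (X k))"
      by (simp add: nn_integral_distr)
    also have "\<dots> = ennreal (\<integral>x. g x \<partial>unif_measure (A (Suc k)))"
      unfolding distr
      by (intro nn_integral_eq_integral integrable_unif_measure A) (auto simp: g_nonneg)
    finally show ?thesis
      using A by (simp add: integral_unif_measure) (simp add: g_def)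
  qed
  \<comment> \<open>Sum and integral are interchanged in the extended nonnegative reals; a finite
    expectation then gives a sum that is finite almost surely.\<close>
  have "(\<integral>\<^sup>+\<omega>. (\<Sum>k. ennreal (g (X k \<omega>))) \<partial>M) = (\<Sum>k. ennreal (?c k))"
    by (subst nn_integral_suminf) (auto simp: g_int)
  also have "\<dots> \<noteq> \<infinity>"
    using suminf_ennreal2[OF c_nonneg sm] by simp
  finally have "AE \<omega> in M. (\<Sum>k. ennreal (g (X k \<omega>))) \<noteq> \<infinity>"
    by (intro nn_integral_PInf_AE) auto
  then have lim: "AE \<omega> in M. (\<lambda>n. \<Sum>k<n. X k \<omega>) \<longlonglongrightarrow> (\<Sum>k. X k \<omega>)"
  proof eventually_elim
    case (elim \<omega>)
    have "summable (\<lambda>k. g (X k \<omega>))"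
      using elim by (intro summable_suminf_not_top) (auto simp: g_nonneg)
    then have "summable (\<lambda>k. norm (X k \<omega>))"
      unfolding g_def by (rule summable_of_summable_ratio[rotated]) simp
    then show ?case
      by (rule summable_LIMSEQ[OF summable_norm_cancel])
  qed
  \<comment> \<open>Where the series diverges, \<open>suminf\<close> still has some value; this
    concerns only a null set.\<close>
  let ?\<mu> = "distr M borel (\<lambda>\<omega>. \<Sum>k. X k \<omega>)"
  have "weakly_converges (conv_seq A) ?\<mu>"
    unfolding weakly_converges_def
  proof (intro allI impI, elim conjE)
    fix f :: "'a \<Rightarrow> real"
    assume f: "continuous_on UNIV f" and "bounded (range f)"
    then obtain B where B: "\<And>x. norm (f x) \<le> B"
      by (auto simp: bounded_iff)
    have [measurable]: "f \<in> borel_measurable borel"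
      using f by (rule borel_measurable_continuous_onI)
    have "(\<lambda>n. \<integral>\<omega>. f (\<Sum>k<n. X k \<omega>) \<partial>M) \<longlonglongrightarrow> (\<integral>\<omega>. f (\<Sum>k. X k \<omega>) \<partial>M)"
    proof (rule integral_dominated_convergence[where w = "\<lambda>_. B"])
      show "AE \<omega> in M. (\<lambda>n. f (\<Sum>k<n. X k \<omega>)) \<longlonglongrightarrow> f (\<Sum>k. X k \<omega>)"
        using lim by eventually_elim (rule continuous_on_tendsto_compose[OF f], auto)
    qed (use B in auto)
    then show "(\<lambda>n. \<integral>x. f x \<partial>conv_seq A n) \<longlonglongrightarrow> (\<integral>x. f x \<partial>?\<mu>)"
      by (simp add: conv_seq_eq_distr[OF indep distr] integral_distr)
  qed
  moreover have "prob_space ?\<mu>"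
    by (intro prob_space_distr) simp
  ultimately show ?thesis
    by (intro exI[of _ ?\<mu>]) simp
qed

section \<open>A multiplicative test function\<close>

text \<open>The l1-norm is additive on the nonnegative orthant, which the Euclidean norm is not in
  general. The absolute values keep the function bounded on the whole space.\<close>

definition exp_l1 :: "'a::euclidean_space \<Rightarrow> real" where
  "exp_l1 x = exp (- (\<Sum>b\<in>Basis. \<bar>x \<bullet> b\<bar>))"

lemma continuous_on_exp_l1: "continuous_on S exp_l1"
  unfolding exp_l1_def by (intro continuous_intros)

lemma borel_measurable_exp_l1 [measurable]: "exp_l1 \<in> borel_measurable borel"
  by (intro borel_measurable_continuous_onI continuous_on_exp_l1)

lemma exp_l1_pos: "0 < exp_l1 x"
  by (simp add: exp_l1_def)

lemma exp_l1_le_1: "exp_l1 x \<le> 1"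
  by (simp add: exp_l1_def sum_nonneg)

lemma exp_l1_sum:
  fixes x :: "'i \<Rightarrow> 'a::ordered_euclidean_space"
  assumes "\<And>k. k \<in> K \<Longrightarrow> 0 \<le> x k"
  shows "exp_l1 (\<Sum>k\<in>K. x k) = (\<Prod>k\<in>K. exp_l1 (x k))"
proof (cases "finite K")
  case True
  have nonneg: "0 \<le> x k \<bullet> b" if "k \<in> K" "b \<in> Basis" for k b
    using assms[OF that(1)] that(2) by (simp add: eucl_le[where x = 0 and y = "x k"])
  have "(\<Sum>b\<in>Basis. \<bar>(\<Sum>k\<in>K. x k) \<bullet> b\<bar>) = (\<Sum>b\<in>Basis. \<Sum>k\<in>K. \<bar>x k \<bullet> b\<bar>)"
    by (intro sum.cong refl) (simp add: inner_sum_left nonneg sum_nonneg)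
  also have "\<dots> = (\<Sum>k\<in>K. \<Sum>b\<in>Basis. \<bar>x k \<bullet> b\<bar>)"
    by (rule sum.swap)
  finally show ?thesis
    using True by (simp add: exp_l1_def exp_sum flip: sum_negf)
\<comment> \<open>For infinite \<open>K\<close> the sum defaults to 0 and the product to 1, in
  agreement with the value 1 at the origin.\<close>
qed (simp add: exp_l1_def)

text \<open>With s the l1-norm of x, take reciprocals in 1 + |x| \<le> 1 + s \<le> exp s.\<close>

lemma ratio_le_one_minus_exp_l1: "norm x / (1 + norm x) \<le> 1 - exp_l1 x"
proof -
  define s where "s = (\<Sum>b\<in>Basis. \<bar>x \<bullet> b\<bar>)"
  have s: "norm x \<le> s"
    unfolding s_def by (rule norm_le_l1)
  have "1 + norm x \<le> exp s"
    using s exp_ge_add_one_self[of s] by linarith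
  moreover have "0 < 1 + norm x"
    by (simp add: add_pos_nonneg)
  ultimately have "inverse (exp s) \<le> inverse (1 + norm x)"
    by (intro le_imp_inverse_le)
  moreover have "norm x / (1 + norm x) = 1 - inverse (1 + norm x)"
    using \<open>0 < 1 + norm x\<close> by (simp add: field_simps)
  ultimately show ?thesis
    by (simp add: exp_l1_def s_def exp_minus)
qed

section \<open>Necessity of the series condition\<close>

text \<open>Since 1 - t \<le> - ln t for t > 0, the logarithm of the product bounds every partial
  sum by \<open>- ln L\<close>.\<close>

lemma summable_one_minus_of_prod_ge:
  fixes m :: "nat \<Rightarrow> real"
  assumes m: "\<And>k. 0 < m k" "\<And>k. m k \<le> 1" and L: "0 < L" "\<And>n. L \<le> (\<Prod>k<n. m k)"
  shows "summable (\<lambda>k. 1 - m k)"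
proof (rule summableI_nonneg_bounded)
  fix n
  have "(\<Sum>k<n. 1 - m k) \<le> (\<Sum>k<n. - ln (m k))"
    using m by (intro sum_mono) (smt (verit) ln_le_minus_one)
  also have "\<dots> = - ln (\<Prod>k<n. m k)"
    using m by (subst ln_prod) (auto simp: sum_negf less_imp_neq[symmetric])
  also have "\<dots> \<le> - ln L"
    using L m by (simp add: prod_pos)
  finally show "(\<Sum>k<n. 1 - m k) \<le> - ln L" .
qed (use m in simp)

lemma summable_of_conv_seq_convergent:
  fixes A :: "nat \<Rightarrow> 'a::ordered_euclidean_space set"
  assumes A: "\<And>k. finite (A (Suc k))" "\<And>k. A (Suc k) \<noteq> {}"
    and nonneg: "\<And>k a. a \<in> A (Suc k) \<Longrightarrow> 0 \<le> a"
    and \<mu>: "sets \<mu> = sets borel" "prob_space \<mu>" "weakly_converges (conv_seq A) \<mu>"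
  shows "summable (\<lambda>k. 1 / real (card (A (Suc k))) * (\<Sum>a\<in>A (Suc k). norm a / (1 + norm a)))"
proof -
  obtain M :: "(nat \<Rightarrow> 'a) measure" and X where M: "prob_space M"
    and indep: "prob_space.indep_vars M (\<lambda>_. borel) X UNIV"
    and distr: "\<And>k. distr M borel (X k) = unif_measure (A (Suc k))"
    by (rule conv_seq_coupling[of A]) (use A in auto)
  interpret prob_space M by fact
  have [measurable]: "random_variable borel (X k)" for k
    using indep by (simp add: indep_vars_def)
  define m where "m k = 1 / real (card (A (Suc k))) * (\<Sum>a\<in>A (Suc k). exp_l1 a)" for k
  have card: "0 < card (A (Suc k))" for k
    using A by (simp add: card_gt_0_iff)
  have m_pos: "0 < m k" for k
    using A card[of k] by (auto simp: m_def intro!: divide_pos_pos sum_pos exp_l1_pos)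
  have m_le: "m k \<le> 1" for k
    using card[of k] sum_bounded_above[of "A (Suc k)" exp_l1 1, OF exp_l1_le_1]
    by (simp add: m_def)
  \<comment> \<open>The variables lie in their sets only almost surely; countability of the indices
    yields one null set for all \<open>k\<close>, off which \<open>exp_l1\<close> is multiplicative
    on the partial sums.\<close>
  have X_nonneg: "AE \<omega> in M. \<forall>k. 0 \<le> X k \<omega>"
  proof (subst AE_all_countable, intro allI)
    fix k
    have "AE x in distr M borel (X k). x \<in> A (Suc k)"
      unfolding distr by (rule AE_unif_measure[OF A])
    then have "AE \<omega> in M. X k \<omega> \<in> A (Suc k)"
      by (rule AE_distrD[rotated]) simp
    then show "AE \<omega> in M. 0 \<le> X k \<omega>"
      by eventually_elim (rule nonneg)
  qed
  have int_prod: "(\<integral>x. exp_l1 x \<partial>conv_seq A n) = (\<Prod>k<n. m k)" for n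
  proof -
    have "(\<integral>x. exp_l1 x \<partial>conv_seq A n) = (\<integral>\<omega>. exp_l1 (\<Sum>k<n. X k \<omega>) \<partial>M)"
      by (simp add: conv_seq_eq_distr[OF indep distr] integral_distr)
    also have "\<dots> = (\<integral>\<omega>. (\<Prod>k<n. exp_l1 (X k \<omega>)) \<partial>M)"
      by (rule integral_cong_AE) (use X_nonneg in \<open>auto simp: exp_l1_sum elim: eventually_mono\<close>)
    also have "\<dots> = (\<Prod>k<n. \<integral>\<omega>. exp_l1 (X k \<omega>) \<partial>M)"
    proof (rule indep_vars_lebesgue_integral)
      show "indep_vars (\<lambda>_. borel) (\<lambda>k \<omega>. exp_l1 (X k \<omega>)) {..<n}"
        by (rule indep_vars_compose2[OF indep_vars_subset[OF indep]]) auto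
      show "integrable M (\<lambda>\<omega>. exp_l1 (X k \<omega>))" for k
        by (rule integrable_const_bound[where B = 1])
           (auto simp: exp_l1_le_1 less_imp_le[OF exp_l1_pos])
    qed simp
    also have "\<dots> = (\<Prod>k<n. \<integral>x. exp_l1 x \<partial>distr M borel (X k))"
      by (simp add: integral_distr)
    finally show ?thesis
      using A by (simp add: distr integral_unif_measure m_def)
  qed
  define L where "L = (\<integral>x. exp_l1 x \<partial>\<mu>)"
  have "bounded (range (exp_l1 :: 'a \<Rightarrow> real))"
    by (auto simp: bounded_iff exp_l1_le_1 less_imp_le[OF exp_l1_pos] intro!: exI[of _ 1])
  with \<mu> have "(\<lambda>n. \<Prod>k<n. m k) \<longlonglongrightarrow> L"
    by (auto simp: weakly_converges_def continuous_on_exp_l1 L_def simp flip: int_prod)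
  \<comment> \<open>The factors are at most 1, so the products decrease and their limit
    \<open>L\<close> is a lower bound for all of them.\<close>
  moreover have "decseq (\<lambda>n. \<Prod>k<n. m k)"
    by (intro decseq_SucI) (simp add: m_le m_pos less_imp_le prod_nonneg mult_left_le)
  ultimately have L_le: "L \<le> (\<Prod>k<n. m k)" for n
    by (rule decseq_ge[rotated])
  \<comment> \<open>A strictly positive function has a positive integral against a probability
    measure: here it matters that the weak limit has lost no mass.\<close>
  have "0 < L"
  proof -
    interpret \<mu>: prob_space \<mu> by fact
    have [measurable_cong]: "sets \<mu> = sets borel" by fact
    have "integrable \<mu> exp_l1"
      by (rule \<mu>.integrable_const_bound[where B = 1])
         (auto simp: exp_l1_le_1 less_imp_le[OF exp_l1_pos])
    then show ?thesis
      unfolding L_def by (rule \<mu>.expectation_greater) (simp add: exp_l1_pos)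
  qed
  with m_pos m_le L_le have "summable (\<lambda>k. 1 - m k)"
    by (intro summable_one_minus_of_prod_ge)
  then show ?thesis
  proof (rule summable_comparison_test'[where N = 0])
    fix k
    have "(\<Sum>a\<in>A (Suc k). norm a / (1 + norm a)) \<le> (\<Sum>a\<in>A (Suc k). 1 - exp_l1 a)"
      by (intro sum_mono ratio_le_one_minus_exp_l1)
    then have "1 / real (card (A (Suc k))) * (\<Sum>a\<in>A (Suc k). norm a / (1 + norm a))
        \<le> 1 / real (card (A (Suc k))) * (\<Sum>a\<in>A (Suc k). 1 - exp_l1 a)"
      by (intro mult_left_mono) auto
    also have "\<dots> = 1 - m k"
      using card[of k] by (simp add: m_def sum_subtractf field_simps)
    finally show "norm (1 / real (card (A (Suc k))) * (\<Sum>a\<in>A (Suc k). norm a / (1 + norm a))) \<le> 1 - m k"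
      by (simp add: sum_nonneg)
  qed
qed

theorem theorem1p1:
  fixes A :: "nat \<Rightarrow> (real ^ 'd) set"
  assumes "\<And>k. k \<ge> 1 \<Longrightarrow> finite (A k)"
    and "\<And>k a i. k \<ge> 1 \<Longrightarrow> a \<in> A k \<Longrightarrow> a $ i \<ge> 0"
    and "\<And>k. k \<ge> 1 \<Longrightarrow> card (A k) \<ge> 2"
  shows "(\<exists>\<mu> :: (real ^ 'd) measure. sets \<mu> = sets borel \<and> prob_space \<mu> \<and>
            weakly_converges (conv_seq A) \<mu>)
     \<longleftrightarrow> summable (\<lambda>k. 1 / real (card (A (Suc k))) * (\<Sum>a\<in>A (Suc k). norm a / (1 + norm a)))"
proof -
  have fin: "finite (A (Suc k))" for k
    using assms(1) by simp
  have ne: "A (Suc k) \<noteq> {}" for k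
    using assms(3)[of "Suc k"] by auto
  have nonneg: "0 \<le> a" if "a \<in> A (Suc k)" for k a
    using assms(2)[OF _ that] by (simp add: less_eq_vec_def)
  show ?thesis (is "?conv \<longleftrightarrow> ?summable")
  proof
    assume ?conv
    then obtain \<mu> where "sets \<mu> = sets borel" "prob_space \<mu>" "weakly_converges (conv_seq A) \<mu>"
      by (elim exE conjE)
    then show ?summable
      by (rule summable_of_conv_seq_convergent[of A, rotated 3]) (fact fin ne nonneg)+
  next
    assume ?summable
    then show ?conv
      by (rule conv_seq_convergent_of_summable[of A, rotated 2]) (fact fin ne)+
  qed
qed

end
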